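(* Let $d,N,M,L\in\mathbb{N}^+$ with $L\ge 2$, let $0\le x_1<\dots<x_N\le 1$, and let $\Gamma=\{\boldsymbol{x}_{\boldsymbol\alpha}:\boldsymbol\alpha\in\Lambda\}\subset[0,1]^d$ be the associated Cartesian grid, where $\Lambda=\{1,\dots,N\}^d$ and $\boldsymbol{x}_{\boldsymbol\alpha}=(x_{\alpha_1},\dots,x_{\alpha_d})^\top$. Let $\boldsymbol{A}\in\mathbb{R}^{N^d\times N^d}$ be an invertible matrix, let $\boldsymbol{b}\in\mathbb{R}^{N^d}$, and let $\boldsymbol{u}=(u_{\boldsymbol\alpha})_{\boldsymbol\alpha\in\Lambda}\in\mathbb{R}^{N^d}$ be the solution of $\boldsymbol{A}\boldsymbol{u}=\boldsymbol{b}$. Let $\phi(\cdot;\theta):\mathbb{R}^d\to\mathbb{R}$ denote the fully connected ReLU neural network of depth $L$ and width $M$ with parameters $\theta$, let $\boldsymbol\phi(\theta):=(\phi(\boldsymbol{x}_{\boldsymbol\alpha};\theta))_{\boldsymbol\alpha\in\Lambda}\in\mathbb{R}^{N^d}$, and let $\theta^*$ be a (global) minimizer over all parameters $\theta$ of $$L(\theta)=\frac{1}{N^d}\,\|\boldsymbol{A}\boldsymbol\phi(\theta)-\boldsymbol{b}\|_2^2 .$$ Then $$\|\boldsymbol\phi(\theta^* )-\boldsymbol{u}\|_{\ell^2}\;\le\;4\,\kappa(\boldsymbol{A})\,\|\boldsymbol{u}\|_{\mathcal{B},\Gamma}\,\sqrt{\frac{d+1}{M}},$$ where $\kappa(\boldsymbol{A}):=\|\boldsymbol{A}\|_2\|\boldsymbol{A}^{-1}\|_2$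 is the condition number of $\boldsymbol{A}$.
   Context: Vectors in $\mathbb{R}^{N^d}$ are indexed by the multi-indices $\boldsymbol\alpha\in\Lambda$ in lexicographic order. $\|\cdot\|_2$ is the Euclidean norm on vectors and the induced operator norm on matrices. The normalized norm is $\|\boldsymbol{w}\|_{\ell^2}:=N^{-d/2}\|\boldsymbol{w}\|_2$ for $\boldsymbol{w}\in\mathbb{R}^{N^d}$. Neural networks. $\sigma(y)=\max\{0,y\}$ is the ReLU function, applied entrywise to vectors. The fully connected ReLU network of depth $L\ge 2$ and width $M$ with input dimension $d$ is $$\phi(\boldsymbol{x};\theta)=\boldsymbol{a}^\top\, h_{L-1}\circ h_{L-2}\circ\cdots\circ h_1(\boldsymbol{x}),\qquad h_\ell(\boldsymbol{y})=\sigma(\boldsymbol{W}_\ell\boldsymbol{y}+\boldsymbol{b}_\ell),$$ where $\boldsymbol{W}_1\in\mathbb{R}^{M\times d}$, $\boldsymbol{W}_\ell\in\mathbb{R}^{M\times M}$ for $2\le\ell\le L-1$, $\boldsymbol{b}_\ell\in\mathbb{R}^M$ for $1\le \ell\le L-1$, $\boldsymbol{a}\in\mathbb{R}^M$, and $\theta=\{\boldsymbol{a},\boldsymbol{W}_\ell,\boldsymbol{b}_\ell:1\le\ell\le L-1\}$ ranges over all real parameter values. Barron space. Let $\Omega'=\mathbb{R}\times\mathbb{R}^d\times\mathbb{R}$ with its Borel $\sigma$-algebra. For a function $f:\mathbb{R}^d\to\mathbb{R}$, consider the Borel probability measures $\pi$ on $\Omega'$ such that $$f(\boldsymbol{x})=\int_{\Omega'}a\,\sigma(\boldsymbol{b}^\top\boldsymbol{x}+c)\,\pi(\mathrm{d}a,\mathrm{d}\boldsymbol{b},\mathrm{d}c)\qquad\text{for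 all }\boldsymbol{x}\in\mathbb{R}^d.\qquad( * )$$ The Barron norm is $$\|f\|_{\mathcal{B}}:=\inf_{\pi}\left(\int_{\Omega'}a^2(\|\boldsymbol{b}\|_1+|c|)^2\,\pi(\mathrm{d}a,\mathrm{d}\boldsymbol{b},\mathrm{d}c)\right)^{1/2},$$ the infimum being over all $\pi$ satisfying $( * )$ (with the infimum of the empty set equal to $+\infty$). The Barron space $\mathcal{B}$ is the set of all $f$ with $\|f\|_{\mathcal{B}}<\infty$. Grid Barron norm. For $\boldsymbol{u}\in\mathbb{R}^{N^d}$, $$\|\boldsymbol{u}\|_{\mathcal{B},\Gamma}:=\inf\{\|f\|_{\mathcal{B}}: f\in\mathcal{B},\ f(\boldsymbol{x}_{\boldsymbol\alpha})=u_{\boldsymbol\alpha}\ \text{for all }\boldsymbol\alpha\in\Lambda\}.$$ *)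

theory Defs
  imports "HOL-Probability.Probability"
begin

section \<open>Cartesian grids\<close>

text \<open>
  The dimensions \<open>d\<close>, \<open>N\<close> and \<open>M\<close> are the cardinalities of arbitrary finite index types
  \<open>'d\<close>, \<open>'n\<close> and \<open>'m\<close>; \<open>'n\<close> is in addition linearly ordered, so that it stands for
  \<open>{1, \<dots>, N}\<close>. The multi-indices are the elements of \<open>'n ^ 'd\<close>, and \<open>real ^ ('n ^ 'd)\<close> is the
  space of vectors indexed by them. No order on multi-indices is fixed: the Euclidean norm and
  the matrix operations do not depend on one.
\<close>

definition grid_point :: "('n::finite \<Rightarrow> real) \<Rightarrow> 'n ^ 'd \<Rightarrow> real ^ 'd::finite" where
  "grid_point x \<alpha> = (\<chi> i. x (\<alpha> $ i))"

definition ell2_norm :: "real ^ ('n::finite ^ 'd::finite) \<Rightarrow> real" where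
  "ell2_norm w = real CARD('n) powr (- real CARD('d) / 2) * norm w"

definition cond_number :: "real ^ 'k ^ 'k::finite \<Rightarrow> real" where
  "cond_number A = onorm ((*v) A) * onorm ((*v) (matrix_inv A))"


section \<open>Fully connected ReLU networks\<close>

definition relu :: "real \<Rightarrow> real" where
  "relu y = max 0 y"

text \<open>
  A network of depth \<open>L\<close> only reads \<open>weight \<theta> l\<close> for \<open>2 \<le> l \<le> L - 1\<close> and
  \<open>bias \<theta> l\<close> for \<open>1 \<le> l \<le> L - 1\<close>. The remaining values are irrelevant, so one type of
  parameters serves all depths.
\<close>

record ('d::finite, 'm::finite) relu_params =
  first_weight :: "real ^ 'd ^ 'm"
  weight :: "nat \<Rightarrow> real ^ 'm ^ 'm"
  bias :: "nat \<Rightarrow> real ^ 'm"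
  out_weight :: "real ^ 'm"

definition relu_layer :: "real ^ 'k::finite ^ 'm::finite \<Rightarrow> real ^ 'm \<Rightarrow> real ^ 'k \<Rightarrow> real ^ 'm" where
  "relu_layer W b y = (\<chi> i. relu ((W *v y + b) $ i))"

definition relu_network ::
  "nat \<Rightarrow> ('d::finite, 'm::finite) relu_params \<Rightarrow> real ^ 'd \<Rightarrow> real" where
  "relu_network L \<theta> x =
     out_weight \<theta> \<bullet>
       fold (\<lambda>l. relu_layer (weight \<theta> l) (bias \<theta> l)) [2..<L]
         (relu_layer (first_weight \<theta>) (bias \<theta> 1) x)"

definition network_vector ::
  "('n::finite \<Rightarrow> real) \<Rightarrow> nat \<Rightarrow> ('d::finite, 'm::finite) relu_params \<Rightarrow> real ^ ('n ^ 'd)" where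
  "network_vector x L \<theta> = (\<chi> \<alpha>. relu_network L \<theta> (grid_point x \<alpha>))"

definition residual_loss ::
  "real ^ ('n ^ 'd) ^ ('n ^ 'd) \<Rightarrow> real ^ ('n ^ 'd) \<Rightarrow> ('n::finite \<Rightarrow> real) \<Rightarrow> nat
     \<Rightarrow> ('d::finite, 'm::finite) relu_params \<Rightarrow> real" where
  "residual_loss A b x L \<theta> =
     (norm (A *v network_vector x L \<theta> - b))\<^sup>2 / real CARD('n) ^ CARD('d)"


section \<open>Barron space\<close>

definition norm1 :: "real ^ 'd::finite \<Rightarrow> real" where
  "norm1 b = (\<Sum>i\<in>UNIV. \<bar>b $ i\<bar>)"

text \<open>
  Integrability is required explicitly, because the Bochner integral of a non-integrable
  function is \<open>0\<close> by convention.
\<close>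

definition barron_represents ::
  "(real \<times> (real ^ 'd::finite) \<times> real) measure \<Rightarrow> (real ^ 'd \<Rightarrow> real) \<Rightarrow> bool" where
  "barron_represents \<pi> f \<longleftrightarrow>
     sets \<pi> = sets borel \<and> prob_space \<pi> \<and>
     (\<forall>x. integrable \<pi> (\<lambda>(a, b, c). a * relu (b \<bullet> x + c)) \<and>
          f x = (\<integral>(a, b, c). a * relu (b \<bullet> x + c) \<partial>\<pi>))"

definition ennreal_sqrt :: "ennreal \<Rightarrow> ennreal" where
  "ennreal_sqrt t = (if t = \<infinity> then \<infinity> else ennreal (sqrt (enn2real t)))"

definition barron_norm :: "(real ^ 'd::finite \<Rightarrow> real) \<Rightarrow> ennreal" where
  "barron_norm f =
     (INF \<pi> \<in> {\<pi>. barron_represents \<pi> f}.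
        ennreal_sqrt (\<integral>\<^sup>+ (a, b, c). ennreal (a\<^sup>2 * (norm1 b + \<bar>c\<bar>)\<^sup>2) \<partial>\<pi>))"

definition barron_space :: "(real ^ 'd::finite \<Rightarrow> real) set" where
  "barron_space = {f. barron_norm f < \<infinity>}"

definition grid_barron_norm :: "('n::finite \<Rightarrow> real) \<Rightarrow> real ^ ('n ^ 'd::finite) \<Rightarrow> ennreal" where
  "grid_barron_norm x u =
     (INF f \<in> {f \<in> barron_space. \<forall>\<alpha>. f (grid_point x \<alpha>) = u $ \<alpha>}. barron_norm f)"

end

theory Submission
  imports Defs
begin

text \<open>
  A best network is at most \<open>cond_number A\<close> times farther from \<open>u\<close> than any other network, so it
  suffices to exhibit a good one. If \<open>\<pi>\<close> represents \<open>f\<close> on the grid, drawing one neuron at a time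
  so as not to exceed the mean squared error gives \<open>M\<close> neurons whose average has root mean square
  error at most \<open>1 / sqrt M\<close> times the second moment norm of \<open>\<pi>\<close>. Since the outputs of a ReLU
  layer are nonnegative, layers with identity weights extend this shallow network to any depth.
\<close>

section \<open>Sampling from a square integrable distribution\<close>

lemma (in prob_space) exists_le_expectation:
  fixes X :: "'a \<Rightarrow> real"
  assumes "integrable M X" "expectation X \<le> c"
  shows "\<exists>\<omega>\<in>space M. X \<omega> \<le> c"
proof (rule ccontr)
  assume "\<not> ?thesis"
  then have "AE \<omega> in M. c < X \<omega>" by (intro AE_I2) auto
  with assms show False using expectation_less[of "\<lambda>\<omega>. - X \<omega>" "- c"] by simp
qed

text \<open>Greedy selection replaces independence: averaged over the next draw, the cross term with
  the earlier deviations vanishes, so some draw raises the squared norm by at most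
  \<open>W\<close>.\<close>

lemma (in prob_space) exists_sample_sum_deviation:
  fixes v :: "'a \<Rightarrow> 'e::euclidean_space"
  assumes v: "integrable M v" and v2: "integrable M (\<lambda>\<omega>. (norm (v \<omega>))\<^sup>2)"
    and W: "expectation (\<lambda>\<omega>. (norm (v \<omega>))\<^sup>2) \<le> W"
    and "finite J"
  shows "\<exists>\<omega>. (norm (\<Sum>j\<in>J. v (\<omega> j) - expectation v))\<^sup>2 \<le> real (card J) * W"
  using \<open>finite J\<close>
proof (induction J rule: finite_induct)
  case empty
  then show ?case by simp
next
  case (insert i J)
  let ?u = "expectation v"
  from insert.IH obtain \<omega> where \<omega>: "(norm (\<Sum>j\<in>J. v (\<omega> j) - ?u))\<^sup>2 \<le> real (card J) * W"
    by blast
  define S where "S = (\<Sum>j\<in>J. v (\<omega> j) - ?u)"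
  \<comment> \<open>Grouping the constants into \<open>S - ?u\<close> leaves a quadratic, a linear
    and a constant term in \<open>v z\<close>, each of them integrable.\<close>
  have expand: "(norm (v z - ?u + S))\<^sup>2
      = (norm (v z))\<^sup>2 + 2 * ((S - ?u) \<bullet> v z) + (norm (S - ?u))\<^sup>2" for z
    unfolding power2_norm_eq_inner by (simp add: inner_simps inner_commute algebra_simps)
  have int: "integrable M (\<lambda>z. (norm (v z - ?u + S))\<^sup>2)"
    unfolding expand using v v2 by simp
  have "expectation (\<lambda>z. (norm (v z - ?u + S))\<^sup>2)
      = expectation (\<lambda>z. (norm (v z))\<^sup>2) + 2 * ((S - ?u) \<bullet> ?u) + (norm (S - ?u))\<^sup>2"
    unfolding expand using v v2 by (simp add: prob_space)
  also have "\<dots> = expectation (\<lambda>z. (norm (v z))\<^sup>2) + (norm S)\<^sup>2 - (norm ?u)\<^sup>2"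
    unfolding power2_norm_eq_inner[of S] power2_norm_eq_inner[of ?u]
      power2_norm_eq_inner[of "S - ?u"]
    by (simp add: inner_simps inner_commute algebra_simps)
  \<comment> \<open>The variance is bounded by the second moment by dropping the squared norm of the
    mean.\<close>
  also have "\<dots> \<le> W + real (card J) * W"
    using W \<omega> zero_le_power2[of "norm ?u"] unfolding S_def by linarith
  finally obtain z where z: "(norm (v z - ?u + S))\<^sup>2 \<le> W + real (card J) * W"
    using exists_le_expectation[OF int] by blast
  \<comment> \<open>Since \<open>i\<close> lies outside \<open>J\<close>, redefining
    \<open>\<omega>\<close> at \<open>i\<close> keeps the earlier draws.\<close>
  have "(\<Sum>j\<in>J. v (fun_upd \<omega> i z j) - ?u) = S"
    unfolding S_def using insert.hyps by (intro sum.cong) auto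
  then have "(norm (\<Sum>j\<in>insert i J. v (fun_upd \<omega> i z j) - ?u))\<^sup>2 \<le> real (card (insert i J)) * W"
    using z insert.hyps by (simp add: algebra_simps)
  then show ?case by blast
qed

lemma (in prob_space) exists_sample_mean:
  fixes v :: "'a \<Rightarrow> 'e::euclidean_space"
  assumes "integrable M v" "integrable M (\<lambda>\<omega>. (norm (v \<omega>))\<^sup>2)"
    and "expectation (\<lambda>\<omega>. (norm (v \<omega>))\<^sup>2) \<le> W"
  shows "\<exists>\<omega> :: 'm::finite \<Rightarrow> 'a.
    (norm ((\<Sum>j\<in>UNIV. v (\<omega> j)) /\<^sub>R real CARD('m) - expectation v))\<^sup>2 \<le> W / real CARD('m)"
proof -
  obtain \<omega> :: "'m \<Rightarrow> 'a" where \<omega>: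
    "(norm (\<Sum>j\<in>UNIV. v (\<omega> j) - expectation v))\<^sup>2 \<le> real CARD('m) * W"
    using exists_sample_sum_deviation[OF assms, of "UNIV :: 'm set"] by auto
  have "(\<Sum>j\<in>UNIV. v (\<omega> j)) /\<^sub>R real CARD('m) - expectation v
      = (\<Sum>j\<in>UNIV. v (\<omega> j) - expectation v) /\<^sub>R real CARD('m)"
    by (simp add: sum_subtractf sum_constant_scaleR scaleR_diff_right)
  then have "(norm ((\<Sum>j\<in>UNIV. v (\<omega> j)) /\<^sub>R real CARD('m) - expectation v))\<^sup>2
      = (norm (\<Sum>j\<in>UNIV. v (\<omega> j) - expectation v))\<^sup>2 / (real CARD('m))\<^sup>2"
    by (simp add: power_mult_distrib divide_inverse power_inverse mult.commute)
  also have "\<dots> \<le> real CARD('m) * W / (real CARD('m))\<^sup>2"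
    by (intro divide_right_mono \<omega>) simp
  also have "\<dots> = W / real CARD('m)"
    by (simp add: power2_eq_square)
  finally show ?thesis by blast
qed

section \<open>Barron functions on finitely many points of the unit cube\<close>

text \<open>Hoelder's inequality pairs the l1 norm of \<open>b\<close> with the sup norm of
  \<open>p\<close>, which is at most 1 in the unit cube. The bound is uniform in \<open>p\<close>
  and matches the weight in the Barron norm.\<close>

lemma abs_relu_affine_le:
  fixes b p :: "real ^ 'd::finite"
  assumes "\<And>i. 0 \<le> p $ i \<and> p $ i \<le> 1"
  shows "\<bar>relu (b \<bullet> p + c)\<bar> \<le> norm1 b + \<bar>c\<bar>"
proof -
  have "\<bar>b \<bullet> p\<bar> \<le> (\<Sum>i\<in>UNIV. \<bar>b $ i * p $ i\<bar>)"
    unfolding inner_vec_def by (simp add: sum_abs)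
  also have "\<dots> \<le> norm1 b"
    unfolding norm1_def
    by (intro sum_mono) (use assms in \<open>simp add: abs_mult mult_left_le\<close>)
  finally show ?thesis
    by (simp add: relu_def max_def) linarith
qed

lemma integrable_vec_lambda:
  fixes g :: "'k::finite \<Rightarrow> 'a \<Rightarrow> real"
  assumes "\<And>k. integrable M (g k)"
  shows "integrable M (\<lambda>\<omega>. \<chi> k. g k \<omega>)"
proof -
  have "(\<lambda>\<omega>. \<chi> k. g k \<omega>) = (\<lambda>\<omega>. \<Sum>k\<in>UNIV. g k \<omega> *\<^sub>R axis k 1)"
    by (auto simp: vec_eq_iff axis_def if_distrib sum.delta cong: if_cong)
  with assms show ?thesis by simp
qed

lemma integral_vec_nth:
  fixes v :: "'a \<Rightarrow> real ^ 'k::finite"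
  assumes "integrable M v"
  shows "(\<integral>\<omega>. v \<omega> \<partial>M) $ k = (\<integral>\<omega>. v \<omega> $ k \<partial>M)"
  using integral_bounded_linear[OF bounded_linear_vec_nth assms] by simp

lemma norm_vec_power2_le:
  fixes v :: "real ^ 'k::finite"
  assumes "\<And>k. \<bar>v $ k\<bar> \<le> h"
  shows "(norm v)\<^sup>2 \<le> real CARD('k) * h\<^sup>2"
proof -
  have "(norm v)\<^sup>2 = (\<Sum>k\<in>UNIV. (v $ k)\<^sup>2)"
    unfolding power2_norm_eq_inner inner_vec_def by (simp add: power2_eq_square)
  also have "\<dots> \<le> (\<Sum>k\<in>(UNIV::'k set). h\<^sup>2)"
    by (intro sum_mono) (metis assms abs_ge_zero power2_abs power_mono)
  finally show ?thesis by simp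
qed

text \<open>A random neuron is viewed as the vector of its values at the points \<open>p k\<close>.
  Its mean is the vector of values of \<open>f\<close>, and its second moment is at most
  \<open>CARD('k) * V\<close>, so the sampling bound applies.\<close>

lemma barron_finite_approx:
  fixes p :: "'k::finite \<Rightarrow> real ^ 'd::finite"
  assumes rep: "barron_represents \<pi> f"
    and V: "(\<integral>\<^sup>+ (a, b, c). ennreal (a\<^sup>2 * (norm1 b + \<bar>c\<bar>)\<^sup>2) \<partial>\<pi>) = ennreal V" "0 \<le> V"
    and p: "\<And>k i. 0 \<le> p k $ i \<and> p k $ i \<le> 1"
  shows "\<exists>(a :: 'm::finite \<Rightarrow> real) b c.
    (norm (\<chi> k. (\<Sum>j\<in>UNIV. a j * relu (b j \<bullet> p k + c j)) / real CARD('m) - f (p k)))\<^sup>2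
      \<le> real CARD('k) * V / real CARD('m)"
proof -
  interpret prob_space \<pi>
    using rep unfolding barron_represents_def by blast
  define H where "H = (\<lambda>(a, b :: real ^ 'd, c). a\<^sup>2 * (norm1 b + \<bar>c :: real\<bar>)\<^sup>2 :: real)"
  define g where "g = (\<lambda>k (a, b, c). a * relu (b \<bullet> p k + c))"
  define v where "v \<omega> = (\<chi> k. g k \<omega>)" for \<omega>
  have sets [measurable_cong]: "sets \<pi> = sets borel"
    using rep by (simp add: barron_represents_def)
  have g: "integrable \<pi> (g k)" "f (p k) = expectation (g k)" for k
    using rep by (auto simp: barron_represents_def g_def)
  have v: "integrable \<pi> v"
    unfolding v_def using g by (intro integrable_vec_lambda)
  have Ev: "expectation v = (\<chi> k. f (p k))"
    by (simp add: vec_eq_iff integral_vec_nth[OF v] g) (simp add: v_def)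
  have "H \<in> borel_measurable borel"
    unfolding H_def case_prod_beta norm1_def
    by (intro borel_measurable_continuous_onI continuous_intros)
  then have H_meas: "H \<in> borel_measurable \<pi>"
    by (simp add: measurable_cong_sets[OF sets refl])
  have H_nonneg: "0 \<le> H \<omega>" for \<omega>
    by (simp add: H_def case_prod_beta)
  \<comment> \<open>For the nonnegative measurable \<open>H\<close>, a finite nonnegative integral
    yields both integrability and the value of the Bochner integral.\<close>
  have "(\<integral>\<^sup>+ \<omega>. ennreal (H \<omega>) \<partial>\<pi>) = ennreal V"
    using V(1) by (simp add: H_def split_beta')
  then have H_int: "integrable \<pi> H" and EH: "expectation H = V"
    using nn_integral_eq_integrable[OF H_meas _ V(2)] H_nonneg by auto
  \<comment> \<open>Every coordinate of \<open>v \<omega>\<close> has square at most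
    \<open>H \<omega>\<close>, and there are \<open>CARD('k)\<close> coordinates.\<close>
  have v_le: "(norm (v \<omega>))\<^sup>2 \<le> real CARD('k) * H \<omega>" for \<omega>
  proof -
    obtain a b c where \<omega>: "\<omega> = (a, b, c)" by (cases \<omega>)
    have "\<bar>v \<omega> $ k\<bar> \<le> \<bar>a\<bar> * (norm1 b + \<bar>c\<bar>)" for k
      by (simp add: v_def g_def \<omega> abs_mult mult_left_mono abs_relu_affine_le p)
    from norm_vec_power2_le[OF this] show ?thesis
      by (simp add: H_def \<omega> power_mult_distrib)
  qed
  have v2: "integrable \<pi> (\<lambda>\<omega>. (norm (v \<omega>))\<^sup>2)"
  proof (rule Bochner_Integration.integrable_bound)
    show "integrable \<pi> (\<lambda>\<omega>. real CARD('k) * H \<omega>)"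
      using H_int by simp
    show "(\<lambda>\<omega>. (norm (v \<omega>))\<^sup>2) \<in> borel_measurable \<pi>"
      using borel_measurable_integrable[OF v] by simp
    show "AE \<omega> in \<pi>. norm ((norm (v \<omega>))\<^sup>2) \<le> norm (real CARD('k) * H \<omega>)"
      using v_le H_nonneg by simp
  qed
  have "expectation (\<lambda>\<omega>. (norm (v \<omega>))\<^sup>2) \<le> expectation (\<lambda>\<omega>. real CARD('k) * H \<omega>)"
    using v2 H_int v_le by (intro integral_mono) auto
  then have Ev2: "expectation (\<lambda>\<omega>. (norm (v \<omega>))\<^sup>2) \<le> real CARD('k) * V"
    using EH by simp
  from exists_sample_mean[OF v v2 Ev2]
  obtain \<omega> :: "'m \<Rightarrow> real \<times> (real ^ 'd) \<times> real" where \<omega>: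
    "(norm ((\<Sum>j\<in>UNIV. v (\<omega> j)) /\<^sub>R real CARD('m) - expectation v))\<^sup>2
      \<le> real CARD('k) * V / real CARD('m)" by blast
  have "(\<Sum>j\<in>UNIV. v (\<omega> j)) /\<^sub>R real CARD('m) - expectation v
    = (\<chi> k. (\<Sum>j\<in>UNIV. fst (\<omega> j) * relu (fst (snd (\<omega> j)) \<bullet> p k + snd (snd (\<omega> j))))
        / real CARD('m) - f (p k))"
    by (simp add: vec_eq_iff Ev v_def g_def case_prod_beta divide_inverse mult.commute)
  with \<omega> show ?thesis by (intro exI) simp
qed

section \<open>Deep networks realize shallow ones\<close>

lemma relu_layer_identity:
  fixes y :: "real ^ 'm::finite"
  assumes "\<And>i. 0 \<le> y $ i"
  shows "relu_layer (mat 1) 0 y = y"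
  using assms by (simp add: relu_layer_def vec_eq_iff relu_def max_def)

lemma fold_relu_layer_identity:
  fixes y :: "real ^ 'm::finite"
  assumes "\<And>i. 0 \<le> y $ i" "\<And>l. l \<in> set ls \<Longrightarrow> W l = mat 1 \<and> \<beta> l = 0"
  shows "fold (\<lambda>l. relu_layer (W l) (\<beta> l)) ls y = y"
  using assms(2) by (induction ls) (simp_all add: relu_layer_identity assms(1))

lemma relu_network_realizes_shallow:
  fixes a c :: "'m::finite \<Rightarrow> real" and b :: "'m \<Rightarrow> real ^ 'd::finite"
  shows "\<exists>\<theta> :: ('d, 'm) relu_params. \<forall>p.
    relu_network L \<theta> p = (\<Sum>j\<in>UNIV. a j * relu (b j \<bullet> p + c j))"
proof
  \<comment> \<open>Layers are numbered from 1, so only the bias at index 1 carries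
    \<open>c\<close>. The later layers fix the nonnegative output of the first; for
    \<open>L = 2\<close> the list \<open>[2..<L]\<close> is empty.\<close>
  let ?\<theta> = "\<lparr>first_weight = (\<chi> j. b j), weight = (\<lambda>l. mat 1),
    bias = (\<lambda>l. if l = 1 then (\<chi> j. c j) else 0), out_weight = (\<chi> j. a j)\<rparr>"
  show "\<forall>p. relu_network L ?\<theta> p = (\<Sum>j\<in>UNIV. a j * relu (b j \<bullet> p + c j))"
  proof
    fix p
    let ?y = "relu_layer (first_weight ?\<theta>) (bias ?\<theta> 1) p"
    have "fold (\<lambda>l. relu_layer (weight ?\<theta> l) (bias ?\<theta> l)) [2..<L] ?y = ?y"
      by (rule fold_relu_layer_identity) (auto simp: relu_layer_def relu_def)
    then show "relu_network L ?\<theta> p = (\<Sum>j\<in>UNIV. a j * relu (b j \<bullet> p + c j))"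
      unfolding relu_network_def
      by (simp add: relu_layer_def inner_vec_def matrix_vector_mult_def)
  qed
qed

section \<open>Residual minimization\<close>

text \<open>\<open>matrix_inv\<close> is a Hilbert choice of a two-sided inverse, and invertibility
  says that the choice has a witness.\<close>

lemma matrix_inv_mult:
  assumes "invertible A"
  shows matrix_inv_left: "matrix_inv A ** A = mat 1"
    and matrix_inv_right: "A ** matrix_inv A = mat 1"
proof -
  have "A ** matrix_inv A = mat 1 \<and> matrix_inv A ** A = mat 1"
    unfolding matrix_inv_def using assms[unfolded invertible_def] by (rule someI_ex)
  then show "matrix_inv A ** A = mat 1" "A ** matrix_inv A = mat 1"
    by auto
qed

lemma onorm_matrix_pos:
  fixes A :: "real ^ 'k ^ 'k::finite"
  assumes "invertible A"
  shows "0 < onorm ((*v) A)"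
proof -
  have lin: "bounded_linear ((*v) A)" by (simp add: matrix_vector_mul_bounded_linear)
  \<comment> \<open>The all-ones vector serves as a nonzero vector whose image cannot
    vanish.\<close>
  have "(1 :: real ^ 'k) = matrix_inv A *v (A *v 1)"
    by (simp add: matrix_vector_mul_assoc matrix_inv_left[OF assms])
  then have "A *v 1 \<noteq> 0" by (metis matrix_vector_mult_0_right one_neq_zero)
  then show ?thesis using onorm_pos_lt[OF lin] by auto
qed

lemma invertible_matrix_inv: "invertible A \<Longrightarrow> invertible (matrix_inv A)"
  for A :: "real ^ 'k ^ 'k::finite"
  unfolding invertible_def[of "matrix_inv A"] using matrix_inv_left matrix_inv_right by blast

lemma cond_number_pos: "invertible A \<Longrightarrow> 0 < cond_number A"
  by (simp add: cond_number_def onorm_matrix_pos invertible_matrix_inv)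

text \<open>Passing from the error of \<open>w\<close> to its residual costs the norm of the
  inverse; passing from the residual of \<open>w'\<close> back to its error costs the norm of
  \<open>A\<close>.\<close>

lemma error_le_cond_number:
  fixes A :: "real ^ 'k ^ 'k::finite"
  assumes A: "invertible A"
    and le: "norm (A *v w - A *v u) \<le> norm (A *v w' - A *v u)"
  shows "norm (w - u) \<le> cond_number A * norm (w' - u)"
proof -
  have lin: "bounded_linear ((*v) B)" for B :: "real ^ 'k ^ 'k"
    by (simp add: matrix_vector_mul_bounded_linear)
  have "w - u = matrix_inv A *v (A *v w - A *v u)"
    by (simp add: matrix_vector_mul_assoc matrix_inv_left[OF A]
        flip: matrix_vector_mult_diff_distrib)
  then have "norm (w - u) \<le> onorm ((*v) (matrix_inv A)) * norm (A *v w - A *v u)"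
    by (metis onorm[OF lin])
  also have "\<dots> \<le> onorm ((*v) (matrix_inv A)) * norm (A *v w' - A *v u)"
    using le onorm_pos_le[OF lin] by (rule mult_left_mono)
  also have "\<dots> = onorm ((*v) (matrix_inv A)) * norm (A *v (w' - u))"
    by (simp add: matrix_vector_mult_diff_distrib)
  also have "\<dots> \<le> onorm ((*v) (matrix_inv A)) * (onorm ((*v) A) * norm (w' - u))"
    using onorm[OF lin] onorm_pos_le[OF lin] by (rule mult_left_mono)
  finally show ?thesis by (simp add: cond_number_def mult_ac)
qed

text \<open>There are N^d multi-indices, so the normalization is the root mean square over the
  grid.\<close>

lemma ell2_norm_eq:
  "ell2_norm (w :: real ^ ('n::finite ^ 'd::finite)) = norm w / sqrt (real CARD('n ^ 'd))"
proof -
  have "real CARD('n) powr (- real CARD('d) / 2) = inverse (real CARD('n) powr (real CARD('d) / 2))"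
    using powr_minus[of "real CARD('n)" "real CARD('d) / 2"] by simp
  also have "real CARD('n) powr (real CARD('d) / 2) = sqrt (real CARD('n ^ 'd))"
    using powr_half_sqrt_powr[of "real CARD('n)" "real CARD('d)"] by (simp add: powr_realpow)
  finally show ?thesis
    by (simp only: ell2_norm_def divide_inverse_commute[of "norm w"])
qed

text \<open>The estimate for a single representing measure with finite second moment
  \<open>V\<close>, stated in real numbers before any infimum is taken.\<close>

lemma minimizer_error_le:
  fixes x :: "'n::finite \<Rightarrow> real"
    and A :: "real ^ ('n ^ 'd::finite) ^ ('n ^ 'd)"
    and \<theta>_opt :: "('d, 'm::finite) relu_params"
  assumes x: "\<And>i. 0 \<le> x i \<and> x i \<le> 1"
    and A: "invertible A" "A *v u = b"
    and opt: "\<And>\<theta> :: ('d, 'm) relu_params. residual_loss A b x L \<theta>_opt \<le> residual_loss A b x L \<theta>"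
    and rep: "barron_represents \<pi> f" and f: "\<And>\<alpha>. f (grid_point x \<alpha>) = u $ \<alpha>"
    and V: "(\<integral>\<^sup>+ (a, b, c). ennreal (a\<^sup>2 * (norm1 b + \<bar>c\<bar>)\<^sup>2) \<partial>\<pi>) = ennreal V" "0 \<le> V"
  shows "ell2_norm (network_vector x L \<theta>_opt - u) \<le> cond_number A * sqrt (V / real CARD('m))"
proof -
  have p: "0 \<le> grid_point x \<alpha> $ i \<and> grid_point x \<alpha> $ i \<le> 1" for \<alpha> i
    using x by (simp add: grid_point_def)
  obtain a c :: "'m \<Rightarrow> real" and b' where approx:
    "(norm (\<chi> \<alpha>. (\<Sum>j\<in>UNIV. a j * relu (b' j \<bullet> grid_point x \<alpha> + c j)) / real CARD('m)
        - f (grid_point x \<alpha>)))\<^sup>2 \<le> real CARD('n ^ 'd) * V / real CARD('m)"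
    using barron_finite_approx[OF rep V, of "grid_point x"] p by blast
  \<comment> \<open>The factor \<open>1 / CARD('m)\<close> of the sample average is absorbed into
    the output weights.\<close>
  obtain \<theta> :: "('d, 'm) relu_params" where \<theta>:
    "\<And>q. relu_network L \<theta> q = (\<Sum>j\<in>UNIV. a j / real CARD('m) * relu (b' j \<bullet> q + c j))"
    using relu_network_realizes_shallow[of L "\<lambda>j. a j / real CARD('m)" b' c] by blast
  have "network_vector x L \<theta> - u
      = (\<chi> \<alpha>. (\<Sum>j\<in>UNIV. a j * relu (b' j \<bullet> grid_point x \<alpha> + c j)) / real CARD('m)
        - f (grid_point x \<alpha>))"
    by (simp add: vec_eq_iff network_vector_def \<theta> f sum_divide_distrib)
  with approx have "norm (network_vector x L \<theta> - u) \<le> sqrt (real CARD('n ^ 'd) * V / real CARD('m))"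
    by (simp add: real_le_rsqrt)
  also have "\<dots> = sqrt (real CARD('n ^ 'd)) * sqrt (V / real CARD('m))"
    by (simp flip: real_sqrt_mult)
  finally have good: "norm (network_vector x L \<theta> - u)
      \<le> sqrt (real CARD('n ^ 'd)) * sqrt (V / real CARD('m))" .
  \<comment> \<open>With \<open>b = A *v u\<close> the loss is the squared residual over N^d, a
    positive factor common to both sides.\<close>
  have "(norm (A *v network_vector x L \<theta>_opt - A *v u))\<^sup>2
      \<le> (norm (A *v network_vector x L \<theta> - A *v u))\<^sup>2"
    using opt[of \<theta>] by (simp add: residual_loss_def A(2) divide_le_cancel)
  then have "norm (A *v network_vector x L \<theta>_opt - A *v u)
      \<le> norm (A *v network_vector x L \<theta> - A *v u)"
    by (rule power2_le_imp_le) simp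
  then have "norm (network_vector x L \<theta>_opt - u)
      \<le> cond_number A * norm (network_vector x L \<theta> - u)"
    by (rule error_le_cond_number[OF A(1)])
  also have "\<dots> \<le> cond_number A * (sqrt (real CARD('n ^ 'd)) * sqrt (V / real CARD('m)))"
    using good cond_number_pos[OF A(1)] by (intro mult_left_mono) auto
  finally show ?thesis
    by (simp add: ell2_norm_eq pos_divide_le_eq mult_ac)
qed

theorem theorem3p2:
  fixes x :: "'n::{finite, linorder} \<Rightarrow> real"
    and L :: nat
    and A :: "real ^ ('n ^ 'd::finite) ^ ('n ^ 'd)"
    and b u :: "real ^ ('n ^ 'd)"
    and \<theta>_opt :: "('d, 'm::finite) relu_params"
  assumes "L \<ge> 2"
    and "strict_mono x"
    and "\<And>i. 0 \<le> x i \<and> x i \<le> 1"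
    and "invertible A"
    and "A *v u = b"
    and "\<And>\<theta> :: ('d, 'm) relu_params. residual_loss A b x L \<theta>_opt \<le> residual_loss A b x L \<theta>"
  shows "ennreal (ell2_norm (network_vector x L \<theta>_opt - u))
           \<le> ennreal (4 * cond_number A) * grid_barron_norm x u
               * ennreal (sqrt ((real CARD('d) + 1) / real CARD('m)))"
proof -
  define e where "e = ell2_norm (network_vector x L \<theta>_opt - u)"
  define K where "K = 4 * cond_number A"
  define s where "s = sqrt ((real CARD('d) + 1) / real CARD('m))"
  have K: "0 < K" using cond_number_pos[OF assms(4)] by (simp add: K_def)
  have s: "0 < s" by (simp add: s_def add_nonneg_pos)
  have e: "0 \<le> e" by (simp add: e_def ell2_norm_def)
  \<comment> \<open>Dividing by the positive constant \<open>K * s\<close> turns the claim into a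
    lower bound for nested infima, to be checked for each \<open>f\<close> and \<open>\<pi>\<close>;
    an empty infimum is infinite and satisfies it.\<close>
  have "ennreal (e / (K * s)) \<le> grid_barron_norm x u"
    unfolding grid_barron_norm_def barron_norm_def
  proof (intro INF_greatest, clarify)
    fix f \<pi>
    assume f: "\<forall>\<alpha>. f (grid_point x \<alpha>) = u $ \<alpha>" and rep: "barron_represents \<pi> f"
    let ?I = "\<integral>\<^sup>+ (a, b, c). ennreal (a\<^sup>2 * (norm1 b + \<bar>c\<bar>)\<^sup>2) \<partial>\<pi>"
    show "ennreal (e / (K * s)) \<le> ennreal_sqrt ?I"
    proof (cases ?I)
      case (real V)
      have "e \<le> cond_number A * sqrt (V / real CARD('m))"
        unfolding e_def using f real
        by (intro minimizer_error_le[OF assms(3-6) rep]) auto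
      \<comment> \<open>Here \<open>cond_number A \<le> K\<close>, and
        \<open>V \<le> (d + 1) * V\<close> because \<open>V\<close> is nonnegative.\<close>
      also have "\<dots> \<le> K * (s * sqrt V)"
      proof (rule mult_mono)
        show "sqrt (V / real CARD('m)) \<le> s * sqrt V"
          unfolding s_def real_sqrt_mult[symmetric]
          using real(1) by (intro real_sqrt_le_mono) (simp add: divide_right_mono distrib_right)
      qed (use K real(1) in \<open>auto simp: K_def\<close>)
      finally have "e / (K * s) \<le> sqrt V"
        using K s by (simp add: pos_divide_le_eq mult_ac)
      with real show ?thesis by (simp add: ennreal_sqrt_def ennreal_leI)
    \<comment> \<open>An infinite second moment has infinite root, so the bound is trivial.\<close>
    qed (simp add: ennreal_sqrt_def)
  qed
  then have "ennreal (K * s) * ennreal (e / (K * s)) \<le> ennreal (K * s) * grid_barron_norm x u"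
    by (rule mult_left_mono) simp
  moreover have "ennreal (K * s) * ennreal (e / (K * s)) = ennreal e"
    using K s e by (simp flip: ennreal_mult)
  moreover have "ennreal (K * s) = ennreal K * ennreal s"
    using K s by (simp add: ennreal_mult)
  ultimately show ?thesis
    unfolding e_def K_def s_def by (simp add: mult_ac)
qed

end
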